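(* (Sternberg Linearization Theorem.) Consider the skew product map $\varphi(\sigma,\rho)=(u(\sigma),\Gamma_\sigma(\rho))$ on $\mathbb{T}\times\mathbb{R}$, where $\Gamma_\sigma(\rho)$ is analytic in $\rho$, $\Gamma_\sigma(0)=0$, $u(\sigma)$ and $\Gamma_\sigma(\rho)$ are continuous in $\sigma$, and $u:\mathbb{T}\to\mathbb{T}$ is invertible. Assume that there exists a constant $\lambda>1$ such that for every sufficiently small $\delta>0$ there is $\gamma>0$ with $$|\Gamma_\sigma'(\rho)-\lambda|<\delta\qquad\text{for all }\rho\in B^{\mathbb{C}}_\gamma(0)\text{ and }\sigma\in\mathbb{T}.$$ Then there exists an invertible coordinate transformation $H$ of $\mathbb{T}\times\mathbb{R}$, defined near the invariant circle $\mathbb{T}\times\{0\}$, such that $$H^{-1}\circ\varphi\circ H(\sigma,\rho)=(u(\sigma),A_\sigma\rho)$$ near $\mathbb{T}\times\{0\}$, where $A_\sigma=\Gamma_\sigma'(0)$. Moreover, the transformation $H$ is analytic in $\rho$ and continuous in $\sigma$.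
   Context: $\mathbb{T}=\mathbb{R}/\mathbb{Z}$. $B_\gamma^{\mathbb{C}}(0)$ is the closed ball of radius $\gamma$ centered at $0$ in the complex plane, and $\Gamma_\sigma'$ denotes the derivative with respect to $\rho$ (of the complex-analytic extension of $\Gamma_\sigma$ near $\rho=0$). The map $\varphi$ describes the dynamics in a small neighborhood of an invariant circle, which is $\mathbb{T}\times\{\rho=0\}$ in these coordinates. *)

theory Defs
  imports "HOL-Complex_Analysis.Complex_Analysis"
begin

quotient_type circle = real / "\<lambda>x y::real. x - y \<in> \<int>"
proof (rule equivpI)
  show "reflp (\<lambda>x y::real. x - y \<in> \<int>)"
    by (simp add: reflp_def)
  show "symp (\<lambda>x y::real. x - y \<in> \<int>)"
    by (metis (mono_tags, lifting) Ints_minus minus_diff_eq sympI)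
  show "transp (\<lambda>x y::real. x - y \<in> \<int>)"
  proof (rule transpI)
    fix x y z :: real
    assume "x - y \<in> \<int>" "y - z \<in> \<int>"
    then have "(x - y) + (y - z) \<in> \<int>" by (rule Ints_add)
    then show "x - z \<in> \<int>" by simp
  qed
qed

instantiation circle :: topological_space
begin

definition open_circle :: "circle set \<Rightarrow> bool"
  where "open_circle U \<longleftrightarrow> open (abs_circle -` U)"

instance
  by standard (auto simp: open_circle_def vimage_Union)

end

definition real_analytic_on :: "(real \<Rightarrow> real) \<Rightarrow> real set \<Rightarrow> bool"
  where "real_analytic_on f S \<longleftrightarrow>
    (\<forall>x\<in>S. \<exists>r>0. \<exists>a. \<forall>y. \<bar>y - x\<bar> < r \<longrightarrow> (\<lambda>n. a n * (y - x) ^ n) sums f y)"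

text \<open>A map into the circle is analytic if it locally lifts to a real analytic function, that is,
  if it is analytic with respect to the standard charts of the circle.\<close>

definition circle_analytic_on :: "(real \<Rightarrow> circle) \<Rightarrow> real set \<Rightarrow> bool"
  where "circle_analytic_on f S \<longleftrightarrow>
    (\<forall>x\<in>S. \<exists>g. real_analytic_on g {x} \<and> (\<forall>\<^sub>F y in nhds x. f y = abs_circle (g y)))"

definition analytic_in_fibres ::
    "(circle \<times> real \<Rightarrow> circle \<times> real) \<Rightarrow> (circle \<times> real) set \<Rightarrow> bool"
  where "analytic_in_fibres H U \<longleftrightarrow>
    (\<forall>\<sigma>. circle_analytic_on (\<lambda>\<rho>. fst (H (\<sigma>, \<rho>))) {\<rho>. (\<sigma>, \<rho>) \<in> U} \<and>
         real_analytic_on (\<lambda>\<rho>. snd (H (\<sigma>, \<rho>))) {\<rho>. (\<sigma>, \<rho>) \<in> U})"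

text \<open>An analytic extension of \<open>f\<close> to a neighbourhood of the closed complex disc of radius \<open>\<gamma>\<close>;
  its values on that disc are determined by \<open>f\<close>, by the identity theorem.\<close>

definition complex_extension :: "(real \<Rightarrow> real) \<Rightarrow> real \<Rightarrow> (complex \<Rightarrow> complex) \<Rightarrow> bool"
  where "complex_extension f \<gamma> F \<longleftrightarrow>
    F analytic_on cball 0 \<gamma> \<and> (\<forall>x. \<bar>x\<bar> \<le> \<gamma> \<longrightarrow> F (of_real x) = of_real (f x))"

definition skew_product ::
    "(circle \<Rightarrow> circle) \<Rightarrow> (circle \<Rightarrow> real \<Rightarrow> real) \<Rightarrow> circle \<times> real \<Rightarrow> circle \<times> real"
  where "skew_product u \<Gamma> = (\<lambda>(\<sigma>, \<rho>). (u \<sigma>, \<Gamma> \<sigma> \<rho>))"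

definition zero_circle :: "(circle \<times> real) set"
  where "zero_circle = UNIV \<times> {0}"

end

theory Submission imports Defs begin

text \<open>
  The linearizing coordinates are found fibre by fibre as
  \<open>H (\<sigma>, \<rho>) = (\<sigma>, h\<^sub>\<sigma> \<rho>)\<close>.  The conjugacy equation is
  \<open>h\<^sub>\<sigma> (z) = F\<^sub>\<tau> (h\<^sub>\<tau> (z / A\<^sub>\<tau>))\<close> with
  \<open>\<tau> = u\<^sup>-\<^sup>1 \<sigma>\<close>, where \<open>F\<^sub>\<tau>\<close> is the complex extension of
  \<open>\<Gamma>\<^sub>\<tau>\<close>.  It is a fixed-point equation on families of functions tangent to the identity, measured by
  the supremum of \<open>|h\<^sub>\<sigma> z - g\<^sub>\<sigma> z| / |z|\<^sup>2\<close> over the fibres and a small disc.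
  The map \<open>F\<^sub>\<tau>\<close> stretches distances by at most \<open>\<Lambda> + \<delta>\<close>, whereas the substitution of
  \<open>z / A\<^sub>\<tau>\<close> for \<open>z\<close> gains the factor \<open>|A\<^sub>\<tau>|\<^sup>-\<^sup>2\<close>; the
  right-hand side therefore contracts by \<open>(\<Lambda> + \<delta>) / (\<Lambda> - \<delta>)\<^sup>2\<close>, which is below 1 for
  small \<open>\<delta>\<close> because \<open>\<Lambda> < \<Lambda>\<^sup>2\<close>.  The iteration starts at the identity; the first correction is
  of second order by the Schwarz lemma (\<open>quadratic_remainder\<close>), uniformly in the fibre.

  Convergence is uniform over all fibres and over a complex disc of fixed radius
  (\<open>uniform_limit_approx\<close>).  This gives both kinds of regularity: each \<open>h\<^sub>\<sigma>\<close> is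
  holomorphic as a uniform limit of holomorphic functions, and on real points \<open>h\<close> is jointly
  continuous as a uniform limit of jointly continuous functions
  (\<open>continuous_real_linearizer\<close>).  For the approximants, joint continuity needs the
  inverse of \<open>u\<close> to be continuous, which holds because the circle is compact and Hausdorff, and the
  multiplier \<open>A\<^sub>\<sigma>\<close> to be continuous, which holds because it is a uniform limit of difference
  quotients (\<open>continuous_on_slope_at_zero\<close>).

  Finally, \<open>h\<^sub>\<sigma>\<close> differs from the identity by a function with Lipschitz constant
  \<open>1/2\<close>, so it is strictly increasing on a real interval common to all fibres, and a
  jointly continuous family of strictly increasing functions is a homeomorphism onto an open set
  (\<open>fibrewise_strict_mono_homeomorphism\<close>).
\<close>

section \<open>Topology of the circle\<close>

text \<open>This embeds the circle in the complex plane, from which the Hausdorff property is pulled back.\<close>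

lift_definition circle_to_complex :: "circle \<Rightarrow> complex" is "\<lambda>t. cis (2 * pi * t)"
proof -
  fix x y :: real
  assume "x - y \<in> \<int>"
  then obtain k where "x - y = of_int k" by (auto elim: Ints_cases)
  then have "2 * pi * x = 2 * pi * y + 2 * pi * of_int k"
    by (metis add.commute diff_add_cancel distrib_left)
  moreover have "cis (2 * pi * of_int k) = 1"
    by (simp add: cis_multiple_2pi)
  ultimately show "cis (2 * pi * x) = cis (2 * pi * y)"
    by (simp flip: cis_mult)
qed

lemma continuous_on_abs_circle: "continuous_on S abs_circle"
  by (rule continuous_on_subset[of UNIV])
     (auto simp: continuous_on_open_vimage open_circle_def)

lemma continuous_on_circle_to_complex: "continuous_on UNIV circle_to_complex"
proof -
  have "open (circle_to_complex -` B)" if "open B" for B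
  proof -
    have "abs_circle -` (circle_to_complex -` B) = (\<lambda>t. cis (2 * pi * t)) -` B"
      by (auto simp: circle_to_complex.abs_eq)
    moreover have "continuous_on UNIV (\<lambda>t. cis (2 * pi * t))"
      by (intro continuous_intros)
    ultimately show ?thesis
      using that by (simp add: open_circle_def continuous_on_open_vimage)
  qed
  then show ?thesis by (simp add: continuous_on_open_vimage)
qed

lemma inj_circle_to_complex: "inj circle_to_complex"
proof (rule injI, transfer)
  fix x y :: real
  assume "cis (2 * pi * x) = cis (2 * pi * y)"
  then have "cis (2 * pi * x - 2 * pi * y) = 1"
    by (simp flip: cis_divide)
  then have "cos (2 * pi * (x - y)) = 1"
    by (simp add: complex_eq_iff algebra_simps)
  then obtain k :: int where "2 * pi * (x - y) = of_int k * 2 * pi"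
    by (auto simp: cos_one_2pi_int)
  then have "x - y = of_int k" by simp
  then show "x - y \<in> \<int>" by simp
qed

instance circle :: t2_space
proof
  fix x y :: circle
  assume "x \<noteq> y"
  then have "circle_to_complex x \<noteq> circle_to_complex y"
    using inj_circle_to_complex by (auto dest: injD)
  from hausdorff[OF this] obtain S T where "open S" "open T" "circle_to_complex x \<in> S" "circle_to_complex y \<in> T"
      "S \<inter> T = {}"
    by blast
  then show "\<exists>U V. open U \<and> open V \<and> x \<in> U \<and> y \<in> V \<and> U \<inter> V = {}"
    using continuous_on_circle_to_complex
    by (intro exI[of _ "circle_to_complex -` S"] exI[of _ "circle_to_complex -` T"])
       (auto simp: continuous_on_open_vimage)
qed

lemma compact_circle: "compact (UNIV :: circle set)"
proof -
  have "\<exists>t\<in>{0..1}. x = abs_circle t" for x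
  proof -
    obtain t where t: "x = abs_circle t"
      by (metis Quotient3_abs_rep[OF Quotient3_circle])
    have "abs_circle t = abs_circle (frac t)"
      by (simp add: circle.abs_eq_iff frac_def)
    then show ?thesis
      using t by (intro bexI[of _ "frac t"]) (auto intro: less_imp_le frac_lt_1)
  qed
  then have "UNIV = abs_circle ` {0..1}" by blast
  then show ?thesis
    using compact_continuous_image[OF continuous_on_abs_circle compact_Icc] by metis
qed

lemma continuous_on_circle_inv:
  fixes u :: "circle \<Rightarrow> circle"
  assumes "continuous_on UNIV u" "bij u"
  shows "continuous_on UNIV (inv u)"
proof -
  have "continuous_on (range u) (inv u)"
    using assms by (intro continuous_on_inv compact_circle) (auto simp: bij_is_inj)
  then show ?thesis using assms(2) by (simp add: bij_is_surj)
qed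

section \<open>Estimates for holomorphic and for real functions\<close>

text \<open>
  Integrating a linear bound on \<open>deriv F z - deriv F 0\<close> gives the quadratic one.  The linear
  bound is the Schwarz lemma for this difference, rescaled to the unit disc: it vanishes at 0 and,
  as both derivatives lie within \<open>d\<close> of \<open>c\<close>, stays below \<open>2 * d\<close>.
\<close>

lemma quadratic_remainder:
  assumes holF: "F holomorphic_on ball 0 \<gamma>" and "0 < \<gamma>" and "F 0 = 0" and "0 < d"
    and deriv_bound: "\<And>z. z \<in> ball 0 \<gamma> \<Longrightarrow> norm (deriv F z - c) < d"
    and z: "z \<in> ball 0 \<gamma>"
  shows "norm (F z - deriv F 0 * z) \<le> 2 * d / \<gamma> * norm z ^ 2"
proof -
  define g :: "complex \<Rightarrow> complex"
    where "g w = (deriv F (\<gamma> * w) - deriv F 0) / (2 * d)" for w :: complex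
  have scale: "of_real \<gamma> * w \<in> ball 0 \<gamma>" if "norm w < 1" for w :: complex
    using that \<open>0 < \<gamma>\<close> by (simp add: norm_mult)
  have hold: "deriv F holomorphic_on ball 0 \<gamma>"
    using holF by (simp add: holomorphic_deriv)
  have hols: "(\<lambda>w. of_real \<gamma> * w) holomorphic_on ball 0 1"
    by (intro holomorphic_intros)
  have "(\<lambda>w::complex. of_real \<gamma> * w) ` ball 0 1 \<subseteq> ball 0 \<gamma>"
    using scale by auto
  then have "(deriv F \<circ> (\<lambda>w. of_real \<gamma> * w)) holomorphic_on ball 0 1"
    by (rule holomorphic_on_compose_gen[OF hols hold])
  then have holg: "g holomorphic_on ball 0 1"
    unfolding g_def o_def using \<open>0 < d\<close> by (intro holomorphic_intros) auto
  have "norm (g w) < 1" if "norm w < 1" for w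
  proof -
    have "norm (deriv F (\<gamma> * w) - deriv F 0) < 2 * d"
      using deriv_bound[OF scale[OF that]] deriv_bound[of 0] \<open>0 < \<gamma>\<close>
        norm_triangle_ineq4[of "deriv F (\<gamma> * w) - c" "deriv F 0 - c"] by simp
    then show ?thesis using \<open>0 < d\<close> by (simp add: g_def norm_divide)
  qed
  then have schwarz: "norm (g w) \<le> norm w" if "norm w < 1" for w
    using Schwarz_Lemma(1)[OF holg _ _ that] by (simp add: g_def)
  have deriv_lip: "norm (deriv F w - deriv F 0) \<le> 2 * d / \<gamma> * norm w" if "w \<in> ball 0 \<gamma>" for w
    using schwarz[of "w / \<gamma>"] that \<open>0 < \<gamma>\<close> \<open>0 < d\<close>
    by (simp add: g_def norm_divide divide_simps mult_ac)
  have "norm ((F z - deriv F 0 * z) - (F 0 - deriv F 0 * 0)) \<le> 2 * d / \<gamma> * norm z * norm (z - 0)"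
  proof (rule field_differentiable_bound[where S = "cball 0 (norm z)"])
    fix w :: complex assume w: "w \<in> cball 0 (norm z)"
    then have "(F has_field_derivative deriv F w) (at w)"
      using z holF by (intro holomorphic_derivI[where S = "ball 0 \<gamma>"]) auto
    then show "((\<lambda>z. F z - deriv F 0 * z) has_field_derivative deriv F w - deriv F 0)
        (at w within cball 0 (norm z))"
      by (auto intro!: derivative_eq_intros dest: has_field_derivative_at_within)
    have "2 * d / \<gamma> * norm w \<le> 2 * d / \<gamma> * norm z"
      using w \<open>0 < d\<close> \<open>0 < \<gamma>\<close> by (intro mult_left_mono) auto
    then show "norm (deriv F w - deriv F 0) \<le> 2 * d / \<gamma> * norm z"
      using deriv_lip[of w] w z by auto
  qed auto
  then show ?thesis using \<open>F 0 = 0\<close> by (simp add: power2_eq_square mult.assoc)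
qed

text \<open>
  Cauchy's inequality on a circle of radius \<open>s\<close> around \<open>x\<close>: on it
  \<open>|e| \<le> M (2 s)\<^sup>2\<close>, so the derivative at \<open>x\<close> is at most
  \<open>4 M s\<close>.  A holomorphic function that is small to second order thus has a small Lipschitz
  constant near 0.
\<close>

lemma quadratic_bound_imp_lipschitz:
  assumes hol: "e holomorphic_on ball 0 (2 * s)" and "0 < s" and "0 \<le> M"
    and bound: "\<And>z. z \<in> ball 0 (2 * s) \<Longrightarrow> norm (e z) \<le> M * norm z ^ 2"
    and zw: "z \<in> ball 0 s" "w \<in> ball 0 s"
  shows "norm (e z - e w) \<le> 4 * M * s * norm (z - w)"
proof (rule field_differentiable_bound[OF convex_ball _ _ zw])
  fix x :: complex assume x: "x \<in> ball 0 s"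
  have sub: "cball x s \<subseteq> ball 0 (2 * s)"
  proof
    fix y assume "y \<in> cball x s"
    then show "y \<in> ball 0 (2 * s)"
      using x norm_triangle_ineq3[of y x] by (auto simp: dist_norm norm_minus_commute)
  qed
  show "(e has_field_derivative deriv e x) (at x within ball 0 s)"
    using x \<open>0 < s\<close>
    by (intro has_field_derivative_at_within[OF holomorphic_derivI[OF hol]]) auto
  have "norm ((deriv ^^ 1) e x) \<le> fact 1 * (4 * M * s ^ 2) / s ^ 1"
  proof (rule Cauchy_inequality)
    show "e holomorphic_on ball x s"
      using hol sub by (meson ball_subset_cball holomorphic_on_subset subset_trans)
    show "continuous_on (cball x s) e"
      using hol sub by (meson holomorphic_on_imp_continuous_on holomorphic_on_subset)
    fix y assume "norm (x - y) = s"
    then have y: "y \<in> ball 0 (2 * s)" using sub by (auto simp: dist_norm)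
    then have "norm y ^ 2 \<le> (2 * s) ^ 2"
      by (intro power_mono) auto
    then have "M * norm y ^ 2 \<le> M * (2 * s) ^ 2"
      using \<open>0 \<le> M\<close> by (rule mult_left_mono)
    then show "norm (e y) \<le> 4 * M * s ^ 2"
      using bound[OF y] by (simp add: power_mult_distrib)
  qed (fact \<open>0 < s\<close>)
  then show "norm (deriv e x) \<le> 4 * M * s"
    using \<open>0 < s\<close> by (simp add: power2_eq_square)
qed

lemma real_derivative_of_complex_extension:
  fixes F :: "complex \<Rightarrow> complex"
  assumes der: "(F has_field_derivative D) (at 0)" and "0 < \<gamma>"
    and ext: "\<And>x. \<bar>x\<bar> < \<gamma> \<Longrightarrow> F (of_real x) = of_real (f x)"
  shows "D = of_real (deriv f 0)"
proof -
  have "((\<lambda>x. F (of_real x)) has_vector_derivative D) (at 0)"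
    using der by (intro has_vector_derivative_real_field) simp
  then have "((\<lambda>x. complex_of_real (f x)) has_vector_derivative D) (at 0)"
    by (rule has_vector_derivative_transform_within_open[where S = "ball 0 \<gamma>"])
       (use \<open>0 < \<gamma>\<close> ext in auto)
  then have "(f has_real_derivative Re D) (at 0)" "((\<lambda>_. 0) has_real_derivative Im D) (at 0)"
    by (auto simp: has_vector_derivative_complex_iff)
  then show ?thesis
    by (metis DERIV_const DERIV_imp_deriv DERIV_unique complex_eq_iff Re_complex_of_real Im_complex_of_real)
qed

text \<open>The power series at a real centre has real powers, so its real part is obtained by replacing
  each coefficient by its real part.\<close>

lemma real_analytic_on_Re_holomorphic:
  assumes hol: "h holomorphic_on ball 0 s"
  shows "real_analytic_on (\<lambda>x. Re (h (of_real x))) (ball 0 s)"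
  unfolding real_analytic_on_def
proof
  fix x :: real assume x: "x \<in> ball 0 s"
  define r where "r = s - \<bar>x\<bar>"
  define a where "a n = (deriv ^^ n) h (of_real x) / fact n" for n
  have "ball (complex_of_real x) r \<subseteq> ball 0 s"
    using x by (subst ball_subset_ball_iff) (auto simp: r_def dist_norm)
  then have hol': "h holomorphic_on ball (of_real x) r" using hol holomorphic_on_subset by blast
  have "(\<lambda>n. Re (a n) * (y - x) ^ n) sums Re (h (of_real y))" if "\<bar>y - x\<bar> < r" for y
  proof -
    have "complex_of_real y \<in> ball (of_real x) r"
      using that by (simp add: dist_norm norm_minus_commute flip: of_real_diff) 
    from sums_Re[OF holomorphic_power_series[OF hol' this]]
    have "(\<lambda>n. Re (a n * (of_real y - of_real x) ^ n)) sums Re (h (of_real y))"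
      by (simp only: a_def)
    moreover have "Re (a n * (of_real y - of_real x) ^ n) = Re (a n) * (y - x) ^ n" for n
      by (simp flip: of_real_diff of_real_power)
    ultimately show ?thesis by simp
  qed
  moreover have "0 < r" using x by (simp add: r_def)
  ultimately show "\<exists>r>0. \<exists>a. \<forall>y. \<bar>y - x\<bar> < r \<longrightarrow> (\<lambda>n. a n * (y - x) ^ n) sums Re (h (of_real y))"
    by (intro exI[of _ r] conjI exI[of _ "\<lambda>n. Re (a n)"]) auto
qed

lemma circle_analytic_on_const: "circle_analytic_on (\<lambda>_. c) S"
  unfolding circle_analytic_on_def
proof
  fix x
  have "real_analytic_on (\<lambda>_. rep_circle c) {x}"
    unfolding real_analytic_on_def
  proof (intro ballI exI conjI allI impI)
    fix z y :: real
    show "(\<lambda>n. (if n = 0 then rep_circle c else 0) * (y - z) ^ n) sums rep_circle c"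
      using sums_single[of 0 "\<lambda>n. rep_circle c * (y - z) ^ n"]
      by (simp add: if_distrib[of "\<lambda>t. t * _"] cong: if_cong)
  qed (rule zero_less_one)
  then show "\<exists>g. real_analytic_on g {x} \<and> (\<forall>\<^sub>F y in nhds x. c = abs_circle (g y))"
    by (intro exI[of _ "\<lambda>_. rep_circle c"])
       (simp add: Quotient3_abs_rep[OF Quotient3_circle])
qed

lemma jointly_continuous_if_lipschitz:
  fixes f :: "'a::topological_space \<Rightarrow> real \<Rightarrow> real"
  assumes cont: "\<And>x. x \<in> S \<Longrightarrow> continuous_on UNIV (\<lambda>\<sigma>. f \<sigma> x)"
    and lip: "\<And>\<sigma> x y. x \<in> S \<Longrightarrow> y \<in> S \<Longrightarrow> \<bar>f \<sigma> x - f \<sigma> y\<bar> \<le> L * \<bar>x - y\<bar>"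
  shows "continuous_on (UNIV \<times> S) (\<lambda>(\<sigma>, x). f \<sigma> x)"
  unfolding continuous_on_def
proof clarify
  fix \<sigma>0 :: 'a and x0 assume x0: "x0 \<in> S"
  let ?F = "at (\<sigma>0, x0) within UNIV \<times> S"
  have "((\<lambda>p. f (fst p) x0) \<longlongrightarrow> f (fst (\<sigma>0, x0)) x0) ?F"
    using continuous_on_compose2[OF cont[OF x0] continuous_on_fst[OF continuous_on_id], of "UNIV \<times> S"]
      x0 unfolding continuous_on_def by auto
  moreover have "((\<lambda>p. f (fst p) (snd p) - f (fst p) x0) \<longlongrightarrow> 0) ?F"
  proof (rule Lim_null_comparison)
    show "\<forall>\<^sub>F p in ?F. norm (f (fst p) (snd p) - f (fst p) x0) \<le> L * \<bar>snd p - x0\<bar>"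
      using lip x0 unfolding eventually_at_topological by (intro exI[of _ UNIV]) auto
    have "continuous_on (UNIV \<times> S) (\<lambda>p::'a \<times> real. L * \<bar>snd p - x0\<bar>)"
      by (intro continuous_intros)
    then show "((\<lambda>p. L * \<bar>snd p - x0\<bar>) \<longlongrightarrow> 0) ?F"
      using x0 unfolding continuous_on_def by fastforce
  qed
  ultimately have "((\<lambda>p. f (fst p) x0 + (f (fst p) (snd p) - f (fst p) x0)) \<longlongrightarrow> f \<sigma>0 x0 + 0) ?F"
    by (intro tendsto_add) auto
  then show "((\<lambda>(\<sigma>, x). f \<sigma> x) \<longlongrightarrow> f \<sigma>0 x0) ?F"
    by (simp add: case_prod_beta')
qed

text \<open>The quadratic error bound makes the difference quotients \<open>f \<sigma> x / x\<close> converge to the slope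
  uniformly in \<open>\<sigma>\<close>.\<close>

lemma continuous_on_slope_at_zero:
  fixes f :: "'a::topological_space \<Rightarrow> real \<Rightarrow> real"
  assumes cont: "\<And>x. continuous_on UNIV (\<lambda>\<sigma>. f \<sigma> x)" and "0 < \<gamma>"
    and rem: "\<And>\<sigma> x. \<bar>x\<bar> < \<gamma> \<Longrightarrow> \<bar>f \<sigma> x - a \<sigma> * x\<bar> \<le> C * x ^ 2"
  shows "continuous_on UNIV a"
proof (rule uniform_limit_theorem)
  show "\<forall>\<^sub>F x in at_right 0. continuous_on UNIV (\<lambda>\<sigma>. f \<sigma> x / x)"
    by (rule eventually_mono[OF eventually_at_right_less[of 0]]) (intro continuous_intros cont, auto)
  show "uniform_limit UNIV (\<lambda>x \<sigma>. f \<sigma> x / x) a (at_right 0)"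
  proof (rule uniform_limitI)
    fix e :: real assume "0 < e"
    have "((\<lambda>x. C * x) \<longlongrightarrow> C * 0) (at_right 0)" by (intro tendsto_intros)
    then have "\<forall>\<^sub>F x in at_right 0. C * x < e" using \<open>0 < e\<close> by (intro order_tendstoD) auto
    moreover have "\<forall>\<^sub>F x in at_right 0. 0 < x \<and> x < \<gamma>"
      using \<open>0 < \<gamma>\<close> eventually_at_right_real by (auto elim: eventually_mono)
    ultimately show "\<forall>\<^sub>F x in at_right 0. \<forall>\<sigma>\<in>UNIV. dist (f \<sigma> x / x) (a \<sigma>) < e"
    proof eventually_elim
      case (elim x)
      show ?case
      proof
        fix \<sigma>
        have "dist (f \<sigma> x / x) (a \<sigma>) = \<bar>f \<sigma> x - a \<sigma> * x\<bar> / x"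
          using elim abs_divide[of "f \<sigma> x - a \<sigma> * x" x]
          by (simp add: dist_real_def diff_divide_distrib)
        also have "\<dots> \<le> C * x ^ 2 / x"
          using elim rem[of x \<sigma>] by (intro divide_right_mono) auto
        also have "\<dots> < e" using elim by (simp add: power2_eq_square)
        finally show "dist (f \<sigma> x / x) (a \<sigma>) < e" .
      qed
    qed
  qed
qed auto

text \<open>
  The image of a box around \<open>(\<sigma>\<^sub>0, x\<^sub>0)\<close> contains, by the intermediate value theorem
  in each fibre, all points strictly between the graphs of \<open>\<sigma> \<mapsto> f \<sigma> (x\<^sub>0 - e)\<close> and
  \<open>\<sigma> \<mapsto> f \<sigma> (x\<^sub>0 + e)\<close>.  This region is open, so the map is open.
\<close>

lemma fibrewise_strict_mono_homeomorphism:
  fixes f :: "'a::topological_space \<Rightarrow> real \<Rightarrow> real"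
  assumes cont: "continuous_on (UNIV \<times> S) (\<lambda>(\<sigma>, x). f \<sigma> x)" and "open S"
    and mono: "\<And>\<sigma>. strict_mono_on S (f \<sigma>)"
  defines "H \<equiv> \<lambda>(\<sigma>, x). (\<sigma>, f \<sigma> x)"
  shows "open (H ` (UNIV \<times> S))" and "\<exists>K. homeomorphism (UNIV \<times> S) (H ` (UNIV \<times> S)) H K"
proof -
  have open_image: "open (H ` N)" if "open N" and N: "N \<subseteq> UNIV \<times> S" for N
  proof (subst open_subopen, rule ballI)
    fix p assume "p \<in> H ` N"
    then obtain \<sigma>0 x0 where p: "p = (\<sigma>0, f \<sigma>0 x0)" and "(\<sigma>0, x0) \<in> N" by (auto simp: H_def)
    then obtain A B where "open A" "open B" "\<sigma>0 \<in> A" "x0 \<in> B" and AB: "A \<times> B \<subseteq> N"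
      using open_prod_elim[OF \<open>open N\<close>] by (metis mem_Sigma_iff)
    then obtain e where "0 < e" and e: "cball x0 e \<subseteq> B"
      using open_contains_cball by blast
    have BS: "B \<subseteq> S" using AB N \<open>\<sigma>0 \<in> A\<close> by auto
    have sub: "{x0 - e..x0 + e} \<subseteq> S" using e BS by (simp add: cball_eq_atLeastAtMost)
    have cf: "continuous_on UNIV (\<lambda>p. f (fst p) x)" if "x \<in> S" for x
      by (rule continuous_on_compose2[OF cont, of UNIV "\<lambda>p. (fst p, x)", simplified])
         (use that in \<open>auto intro!: continuous_intros\<close>)
    define Q where "Q = (A \<times> UNIV) \<inter> {p. f (fst p) (x0 - e) < snd p} \<inter> {p. snd p < f (fst p) (x0 + e)}"
    have "open Q"
      unfolding Q_def using \<open>open A\<close> sub \<open>0 < e\<close>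
      by (intro open_Int open_Times open_Collect_less cf continuous_intros) auto
    moreover have "p \<in> Q"
      using \<open>0 < e\<close> \<open>\<sigma>0 \<in> A\<close> sub
      by (auto simp: Q_def p intro!: strict_mono_onD[OF mono])
    moreover have "Q \<subseteq> H ` N"
    proof
      fix q assume "q \<in> Q"
      then obtain \<sigma> y where q: "q = (\<sigma>, y)" "\<sigma> \<in> A" "f \<sigma> (x0 - e) < y" "y < f \<sigma> (x0 + e)"
        by (cases q) (auto simp: Q_def)
      have "continuous_on {x0 - e..x0 + e} (f \<sigma>)"
        by (rule continuous_on_compose2[OF cont, of "{x0 - e..x0 + e}" "\<lambda>x. (\<sigma>, x)", simplified])
           (use sub in \<open>auto intro!: continuous_intros\<close>)
      then obtain x where "x0 - e \<le> x" "x \<le> x0 + e" "f \<sigma> x = y"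
        using IVT'[of "f \<sigma>" "x0 - e" y "x0 + e"] q \<open>0 < e\<close> by auto
      then show "q \<in> H ` N"
        using AB e q by (intro image_eqI[of _ _ "(\<sigma>, x)"])
          (auto simp: H_def cball_eq_atLeastAtMost)
    qed
    ultimately show "\<exists>T. open T \<and> p \<in> T \<and> T \<subseteq> H ` N" by blast
  qed
  have open_dom: "open (UNIV \<times> S :: ('a \<times> real) set)"
    using \<open>open S\<close> by (intro open_Times) auto
  show open_ran: "open (H ` (UNIV \<times> S))" using open_image open_dom by blast
  have "continuous_on (UNIV \<times> S) H"
    unfolding H_def case_prod_beta
    by (intro continuous_intros) (use cont in \<open>simp add: case_prod_beta\<close>)
  moreover have "inj_on H (UNIV \<times> S)"
    using strict_mono_on_imp_inj_on[OF mono] by (auto simp: H_def inj_on_def)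
  moreover have "openin (top_of_set (H ` (UNIV \<times> S))) (H ` N)"
    if "openin (top_of_set (UNIV \<times> S)) N" for N
    using that open_dom open_ran open_image by (auto simp: openin_open_eq)
  ultimately show "\<exists>K. homeomorphism (UNIV \<times> S) (H ` (UNIV \<times> S)) H K"
    using homeomorphism_injective_open_map[of "UNIV \<times> S" H] by metis
qed

section \<open>Linearization of a non-autonomous expanding iteration\<close>

text \<open>
  The map \<open>v\<close> is the inverse of the base dynamics, so that fibre \<open>\<sigma>\<close> is reached from fibre
  \<open>v \<sigma>\<close>.  The condition \<open>L < m\<^sup>2\<close> is the contraction condition for second-order errors.  The
  last condition on the radius makes \<open>M * r \<le> 1\<close> below, which keeps all approximants on the disc
  of radius \<open>r\<close> at most doubling the modulus, hence inside the common domain of the maps.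
\<close>

locale expanding_cocycle =
  fixes v :: "'a \<Rightarrow> 'a" and F :: "'a \<Rightarrow> complex \<Rightarrow> complex" and A :: "'a \<Rightarrow> complex"
    and \<gamma> L m C r :: real
  assumes holF: "F \<sigma> holomorphic_on ball 0 \<gamma>"
    and lipF: "z \<in> ball 0 \<gamma> \<Longrightarrow> w \<in> ball 0 \<gamma> \<Longrightarrow> norm (F \<sigma> z - F \<sigma> w) \<le> L * norm (z - w)"
    and remF: "z \<in> ball 0 \<gamma> \<Longrightarrow> norm (F \<sigma> z - A \<sigma> * z) \<le> C * norm z ^ 2"
    and A_ge: "m \<le> norm (A \<sigma>)" and m_ge_1: "1 \<le> m"
    and spectral_gap: "L < m ^ 2" and L_nonneg: "0 \<le> L" and C_nonneg: "0 \<le> C"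
    and radius: "0 < r" "2 * r \<le> \<gamma>" "C * r \<le> 1 - L / m ^ 2"
begin

text \<open>The contraction factor, and the sum of the geometric series of second-order corrections.\<close>

definition "q = L / m ^ 2"
definition "M = C / (1 - q)"

text \<open>
  Unfolded, \<open>approx n \<sigma>\<close> divides by the \<open>n\<close> multipliers along the backward orbit of
  \<open>\<sigma>\<close> and then applies the \<open>n\<close> nonlinear maps leading back to \<open>\<sigma>\<close>.
\<close>

primrec approx :: "nat \<Rightarrow> 'a \<Rightarrow> complex \<Rightarrow> complex" where
  "approx 0 \<sigma> z = z"
| "approx (Suc n) \<sigma> z = F (v \<sigma>) (approx n (v \<sigma>) (z / A (v \<sigma>)))"

lemma q_bounds: "0 \<le> q" "q < 1"
  using spectral_gap L_nonneg m_ge_1 by (auto simp: q_def)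

lemma M_bounds: "0 \<le> M" "M * r \<le> 1"
  using q_bounds C_nonneg radius by (auto simp: M_def q_def divide_simps)

lemma A_nonzero: "A \<sigma> \<noteq> 0"
  using A_ge[of \<sigma>] m_ge_1 by auto

lemma norm_divide_le: "norm (z / A \<sigma>) \<le> norm z / m"
  using A_ge[of \<sigma>] m_ge_1 by (auto simp: norm_divide intro!: divide_left_mono mult_pos_pos)

lemma norm_divide_le': "norm (z / A \<sigma>) \<le> norm z"
proof -
  have "norm z / m \<le> norm z / 1" using m_ge_1 by (intro divide_left_mono) auto
  then show ?thesis using norm_divide_le[of z \<sigma>] by simp
qed

lemma divide_in_ball: "z \<in> ball 0 r \<Longrightarrow> z / A \<sigma> \<in> ball 0 r"
  using norm_divide_le'[of z \<sigma>] by (simp del: norm_divide add: dist_norm)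

lemma in_domain:
  assumes "z \<in> ball 0 r" "norm (w - z) \<le> M * norm z ^ 2"
  shows "w \<in> ball 0 \<gamma>"
proof -
  have "M * norm z \<le> M * r"
    using assms(1) M_bounds by (intro mult_left_mono) auto
  then have "M * norm z * norm z \<le> 1 * norm z"
    using M_bounds by (intro mult_right_mono) auto
  then show ?thesis
    using assms radius norm_triangle_sub[of w z] by (auto simp: power2_eq_square mult.assoc)
qed

text \<open>The heart of convergence: an error of order \<open>|z|\<^sup>2\<close> gains \<open>m\<^sup>-\<^sup>2\<close> from dividing the argument
  by the multiplier, which outweighs the expansion \<open>L\<close>.\<close>

lemma quadratic_contraction:
  assumes "norm x \<le> c * norm (z / A \<sigma>) ^ 2" "0 \<le> c"
  shows "L * norm x \<le> q * (c * norm z ^ 2)"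
proof -
  have "norm (z / A \<sigma>) ^ 2 \<le> (norm z / m) ^ 2"
    using norm_divide_le by (intro power_mono) auto
  then have "c * norm (z / A \<sigma>) ^ 2 \<le> c * (norm z / m) ^ 2"
    using assms(2) by (rule mult_left_mono)
  then have "L * norm x \<le> L * (c * (norm z / m) ^ 2)"
    using assms(1) L_nonneg by (intro mult_left_mono) auto
  then show ?thesis by (simp add: q_def power_divide)
qed

text \<open>
  The constant \<open>M\<close> is the fixed point of \<open>M \<mapsto> q * M + C\<close>: one step contracts the inherited
  error by \<open>q\<close> and adds the nonlinearity of a single map.
\<close>

lemma approx_near_identity:
  "z \<in> ball 0 r \<Longrightarrow> norm (approx n \<sigma> z - z) \<le> M * norm z ^ 2"
proof (induction n arbitrary: \<sigma> z)
  case 0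
  then show ?case using M_bounds by simp
next
  case (Suc n)
  define \<tau> where "\<tau> = v \<sigma>"
  define w where "w = z / A \<tau>"
  have w: "w \<in> ball 0 r" using Suc.prems by (simp only: w_def divide_in_ball)
  have near: "norm (approx n \<tau> w - w) \<le> M * norm w ^ 2" by (rule Suc.IH[OF w])
  have dom: "w \<in> ball 0 \<gamma>" "approx n \<tau> w \<in> ball 0 \<gamma>"
    using in_domain[OF w] near M_bounds by auto
  have "norm w ^ 2 \<le> norm z ^ 2"
    unfolding w_def by (intro power_mono norm_divide_le') auto
  then have Cw: "C * norm w ^ 2 \<le> C * norm z ^ 2" using C_nonneg by (rule mult_left_mono)
  have "approx (Suc n) \<sigma> z - z = (F \<tau> (approx n \<tau> w) - F \<tau> w) + (F \<tau> w - A \<tau> * w)"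
    using A_nonzero by (simp add: \<tau>_def w_def)
  also have "norm \<dots> \<le> L * norm (approx n \<tau> w - w) + C * norm w ^ 2"
    by (intro norm_triangle_le add_mono lipF remF dom)
  also have "\<dots> \<le> q * (M * norm z ^ 2) + C * norm z ^ 2"
    using Cw quadratic_contraction[OF near[unfolded w_def] M_bounds(1)] by (simp add: w_def)
  also have "\<dots> = (q * M + C) * norm z ^ 2" by (simp add: algebra_simps)
  also have "q * M + C = M" using q_bounds by (simp add: M_def field_simps)
  finally show ?case .
qed

lemma approx_in_domain: "z \<in> ball 0 r \<Longrightarrow> approx n \<sigma> z \<in> ball 0 \<gamma>"
  using in_domain approx_near_identity by blast

lemma approx_step:
  "z \<in> ball 0 r \<Longrightarrow> norm (approx (Suc n) \<sigma> z - approx n \<sigma> z) \<le> M * q ^ n * norm z ^ 2"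
proof (induction n arbitrary: \<sigma> z)
  case 0
  then show ?case using approx_near_identity[of z 1 \<sigma>] by simp
next
  case (Suc n)
  define w where "w = z / A (v \<sigma>)"
  have w: "w \<in> ball 0 r" using Suc.prems by (simp only: w_def divide_in_ball)
  have "norm (approx (Suc (Suc n)) \<sigma> z - approx (Suc n) \<sigma> z)
      \<le> L * norm (approx (Suc n) (v \<sigma>) w - approx n (v \<sigma>) w)"
    unfolding approx.simps(2)[of _ \<sigma>] w_def[symmetric] by (intro lipF approx_in_domain w)
  also have "\<dots> \<le> q * (M * q ^ n * norm z ^ 2)"
    by (rule quadratic_contraction) (use Suc.IH[OF w] M_bounds q_bounds in \<open>auto simp: w_def\<close>)
  finally show ?case by (simp add: mult_ac)
qed

text \<open>The limit of the approximants, written as a telescoping series so that the Weierstrass M-test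
  gives uniform convergence.\<close>

definition linearizer :: "'a \<Rightarrow> complex \<Rightarrow> complex" where
  "linearizer \<sigma> z = z + (\<Sum>n. approx (Suc n) \<sigma> z - approx n \<sigma> z)"

lemma uniform_limit_approx:
  "uniform_limit (UNIV \<times> ball 0 r) (\<lambda>n (\<sigma>, z). approx n \<sigma> z) (\<lambda>(\<sigma>, z). linearizer \<sigma> z) sequentially"
proof -
  have "uniform_limit (UNIV \<times> ball 0 r)
      (\<lambda>n p. \<Sum>k<n. approx (Suc k) (fst p) (snd p) - approx k (fst p) (snd p))
      (\<lambda>p. \<Sum>k. approx (Suc k) (fst p) (snd p) - approx k (fst p) (snd p)) sequentially"
  proof (rule Weierstrass_m_test)
    show "summable (\<lambda>n. M * r ^ 2 * q ^ n)"
      using q_bounds by (intro summable_mult summable_geometric) auto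
    fix n and p :: "'a \<times> complex"
    assume "p \<in> UNIV \<times> ball 0 r"
    then have p: "snd p \<in> ball 0 r" by auto
    have "norm (snd p) ^ 2 \<le> r ^ 2" using p by (intro power_mono) auto
    then have "M * q ^ n * norm (snd p) ^ 2 \<le> M * q ^ n * r ^ 2"
      using M_bounds q_bounds by (intro mult_left_mono) auto
    then show "norm (approx (Suc n) (fst p) (snd p) - approx n (fst p) (snd p)) \<le> M * r ^ 2 * q ^ n"
      using approx_step[OF p, of n "fst p"] by (simp only: mult_ac)
  qed
  then have "uniform_limit (UNIV \<times> ball 0 r)
      (\<lambda>n p. snd p + (\<Sum>k<n. approx (Suc k) (fst p) (snd p) - approx k (fst p) (snd p)))
      (\<lambda>p. linearizer (fst p) (snd p)) sequentially"
    unfolding linearizer_def by (intro uniform_limit_intros)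
  moreover have "snd p + (\<Sum>k<n. approx (Suc k) (fst p) (snd p) - approx k (fst p) (snd p))
      = approx n (fst p) (snd p)" for n p
    using sum_lessThan_telescope[of "\<lambda>k. approx k (fst p) (snd p)" n] by simp
  ultimately show ?thesis by (simp add: case_prod_beta')
qed

lemma approx_tendsto: "z \<in> ball 0 r \<Longrightarrow> (\<lambda>n. approx n \<sigma> z) \<longlonglongrightarrow> linearizer \<sigma> z"
  using tendsto_uniform_limitI[OF uniform_limit_approx, of "(\<sigma>, z)"] by simp

lemma linearizer_near_identity:
  "z \<in> ball 0 r \<Longrightarrow> norm (linearizer \<sigma> z - z) \<le> M * norm z ^ 2"
  by (rule tendsto_upperbound[where F = sequentially and f = "\<lambda>n. norm (approx n \<sigma> z - z)"])
     (auto intro!: tendsto_intros approx_tendsto always_eventually approx_near_identity)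

lemma linearizer_zero: "linearizer \<sigma> 0 = 0"
  using linearizer_near_identity[of 0 \<sigma>] radius by simp

lemma linearizer_conjugates:
  assumes z: "z \<in> ball 0 r"
  shows "linearizer \<sigma> z = F (v \<sigma>) (linearizer (v \<sigma>) (z / A (v \<sigma>)))"
proof (rule LIMSEQ_unique)
  let ?w = "z / A (v \<sigma>)"
  have w: "?w \<in> ball 0 r" using z by (rule divide_in_ball)
  show "(\<lambda>n. approx (Suc n) \<sigma> z) \<longlonglongrightarrow> linearizer \<sigma> z"
    using approx_tendsto[OF z] by (rule LIMSEQ_Suc)
  have "isCont (F (v \<sigma>)) (linearizer (v \<sigma>) ?w)"
    using in_domain[OF w linearizer_near_identity[OF w]] holF[of "v \<sigma>"]
    by (meson continuous_on_eq_continuous_at holomorphic_on_imp_continuous_on open_ball)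
  then show "(\<lambda>n. approx (Suc n) \<sigma> z) \<longlonglongrightarrow> F (v \<sigma>) (linearizer (v \<sigma>) ?w)"
    unfolding approx.simps(2) by (rule isCont_tendsto_compose) (rule approx_tendsto[OF w])
qed

lemma holomorphic_approx: "approx n \<sigma> holomorphic_on ball 0 r"
proof (induction n arbitrary: \<sigma>)
  case 0
  show ?case by (simp add: holomorphic_on_ident)
next
  case (Suc n)
  have "(\<lambda>z. z / A (v \<sigma>)) holomorphic_on ball 0 r"
    using A_nonzero by (intro holomorphic_intros) auto
  moreover have "(\<lambda>z. z / A (v \<sigma>)) ` ball 0 r \<subseteq> ball 0 r"
    using divide_in_ball by blast
  ultimately have "(approx n (v \<sigma>) \<circ> (\<lambda>z. z / A (v \<sigma>))) holomorphic_on ball 0 r"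
    by (rule holomorphic_on_compose_gen[OF _ Suc.IH])
  moreover have "(approx n (v \<sigma>) \<circ> (\<lambda>z. z / A (v \<sigma>))) ` ball 0 r \<subseteq> ball 0 \<gamma>"
    using approx_in_domain divide_in_ball unfolding o_def by blast
  ultimately have "(F (v \<sigma>) \<circ> (approx n (v \<sigma>) \<circ> (\<lambda>z. z / A (v \<sigma>)))) holomorphic_on ball 0 r"
    by (rule holomorphic_on_compose_gen[OF _ holF])
  then show ?case by (simp add: o_def)
qed

lemma holomorphic_linearizer: "linearizer \<sigma> holomorphic_on ball 0 r"
proof (rule holomorphic_uniform_sequence[OF open_ball holomorphic_approx])
  fix z :: complex assume "z \<in> ball 0 r"
  then obtain d where "0 < d" and d: "cball z d \<subseteq> ball 0 r"
    by (meson open_ball open_contains_cball)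
  have "uniform_limit (cball z d) (\<lambda>n. approx n \<sigma>) (linearizer \<sigma>) sequentially"
  proof (rule uniform_limitI)
    fix e :: real assume "0 < e"
    from uniform_limitD[OF uniform_limit_approx this]
    show "\<forall>\<^sub>F n in sequentially. \<forall>x\<in>cball z d. dist (approx n \<sigma> x) (linearizer \<sigma> x) < e"
      by (rule eventually_mono) (use d in auto)
  qed
  with \<open>0 < d\<close> d
  show "\<exists>d>0. cball z d \<subseteq> ball 0 r \<and> uniform_limit (cball z d) (\<lambda>n. approx n \<sigma>) (linearizer \<sigma>) sequentially"
    by blast
qed

text \<open>
  Passing from \<open>r\<close> to \<open>r / 8\<close> brings the Lipschitz constant \<open>4 * M * (r / 8)\<close> of the
  displacement down to \<open>1 / 2\<close>, as \<open>M * r \<le> 1\<close>; the displacement then cannot undo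
  the monotonicity of the identity on the real line.
\<close>

lemma linearizer_displacement_lipschitz:
  assumes "z \<in> ball 0 (r / 8)" "w \<in> ball 0 (r / 8)"
  shows "norm ((linearizer \<sigma> z - z) - (linearizer \<sigma> w - w)) \<le> norm (z - w) / 2"
proof -
  have "norm ((linearizer \<sigma> z - z) - (linearizer \<sigma> w - w)) \<le> 4 * M * (r / 8) * norm (z - w)"
  proof (rule quadratic_bound_imp_lipschitz[OF _ _ M_bounds(1) _ assms])
    have "linearizer \<sigma> holomorphic_on ball 0 (2 * (r / 8))"
      by (rule holomorphic_on_subset[OF holomorphic_linearizer])
         (use radius in \<open>simp add: ball_subset_ball_iff\<close>)
    then show "(\<lambda>z. linearizer \<sigma> z - z) holomorphic_on ball 0 (2 * (r / 8))"
      by (intro holomorphic_intros)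
    show "norm (linearizer \<sigma> z - z) \<le> M * norm z ^ 2" if "z \<in> ball 0 (2 * (r / 8))" for z
      using that radius by (intro linearizer_near_identity) auto
  qed (use radius in simp)
  also have "\<dots> \<le> 1 / 2 * norm (z - w)"
    using M_bounds by (intro mult_right_mono) (auto simp: mult.commute)
  finally show ?thesis by simp
qed

end

section \<open>Real fibres and continuity along the base\<close>

text \<open>Continuity in the base is assumed for the real maps alone: their joint continuity follows from
  the Lipschitz bound, and the complex extensions enter only one fibre at a time.\<close>

locale real_expanding_cocycle =
  expanding_cocycle v F "\<lambda>\<sigma>. of_real (a \<sigma>)" \<gamma> L m C r
  for v :: "'a::topological_space \<Rightarrow> 'a" and F a \<gamma> L m C r +
  fixes G :: "'a \<Rightarrow> real \<Rightarrow> real"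
  assumes cont_v: "continuous_on UNIV v"
    and cont_G: "continuous_on UNIV (\<lambda>\<sigma>. G \<sigma> x)"
    and F_of_real: "\<bar>x\<bar> < \<gamma> \<Longrightarrow> F \<sigma> (of_real x) = of_real (G \<sigma> x)"
begin

lemma continuous_multiplier: "continuous_on UNIV a"
proof (rule continuous_on_slope_at_zero[OF cont_G])
  show "0 < \<gamma>" using radius by simp
  show "\<bar>G \<sigma> x - a \<sigma> * x\<bar> \<le> C * x ^ 2" if "\<bar>x\<bar> < \<gamma>" for \<sigma> x
    using remF[of "of_real x" \<sigma>] that F_of_real[OF that, of \<sigma>]
    by (simp flip: of_real_mult of_real_diff)
qed

lemma jointly_continuous_G: "continuous_on (UNIV \<times> ball 0 \<gamma>) (\<lambda>(\<sigma>, x). G \<sigma> x)"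
proof (rule jointly_continuous_if_lipschitz[OF cont_G])
  show "\<bar>G \<sigma> x - G \<sigma> y\<bar> \<le> L * \<bar>x - y\<bar>" if "x \<in> ball 0 \<gamma>" "y \<in> ball 0 \<gamma>" for \<sigma> x y
    using lipF[of "of_real x" "of_real y" \<sigma>] F_of_real[of x \<sigma>] F_of_real[of y \<sigma>] that
    by (simp flip: of_real_diff)
qed

definition real_approx :: "nat \<Rightarrow> 'a \<Rightarrow> real \<Rightarrow> real" where
  "real_approx n \<sigma> x = Re (approx n \<sigma> (of_real x))"

definition real_linearizer :: "'a \<Rightarrow> real \<Rightarrow> real" where
  "real_linearizer \<sigma> x = Re (linearizer \<sigma> (of_real x))"

lemma real_divide_in_ball: "x \<in> ball 0 r \<Longrightarrow> x / a \<sigma> \<in> ball 0 r"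
  using divide_in_ball[of "of_real x" \<sigma>] by (simp flip: of_real_divide)

lemma approx_in_Reals: "x \<in> ball 0 r \<Longrightarrow> approx n \<sigma> (of_real x) \<in> \<real>"
proof (induction n arbitrary: \<sigma> x)
  case 0
  then show ?case by simp
next
  case (Suc n)
  let ?x = "x / a (v \<sigma>)"
  obtain y where y: "approx n (v \<sigma>) (of_real ?x) = of_real y"
    using Suc.IH[OF real_divide_in_ball[OF Suc.prems]] by (rule Reals_cases)
  have "\<bar>y\<bar> < \<gamma>"
    using approx_in_domain[of "of_real ?x" n "v \<sigma>"] real_divide_in_ball[OF Suc.prems, of "v \<sigma>"] y
    by (simp del: of_real_divide)
  then show ?case using y F_of_real by simp
qed

lemma of_real_real_approx:
  "x \<in> ball 0 r \<Longrightarrow> of_real (real_approx n \<sigma> x) = approx n \<sigma> (of_real x)"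
  using approx_in_Reals by (simp add: real_approx_def of_real_Re)

lemma of_real_real_linearizer:
  assumes "x \<in> ball 0 r"
  shows "of_real (real_linearizer \<sigma> x) = linearizer \<sigma> (of_real x)"
proof -
  have "linearizer \<sigma> (of_real x) \<in> \<real>"
    by (rule closed_sequentially[OF closed_complex_Reals, of "\<lambda>n. approx n \<sigma> (of_real x)"])
       (use assms approx_in_Reals approx_tendsto in auto)
  then show ?thesis by (simp add: real_linearizer_def of_real_Re)
qed

lemma real_approx_in_ball: "x \<in> ball 0 r \<Longrightarrow> real_approx n \<sigma> x \<in> ball 0 \<gamma>"
  using approx_in_domain[of "of_real x" n \<sigma>] by (simp flip: of_real_real_approx)

lemma real_approx_Suc:
  assumes "x \<in> ball 0 r"
  shows "real_approx (Suc n) \<sigma> x = G (v \<sigma>) (real_approx n (v \<sigma>) (x / a (v \<sigma>)))"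
proof -
  let ?x = "x / a (v \<sigma>)"
  have x: "?x \<in> ball 0 r" using assms by (rule real_divide_in_ball)
  have "real_approx (Suc n) \<sigma> x = Re (F (v \<sigma>) (of_real (real_approx n (v \<sigma>) ?x)))"
    using of_real_real_approx[OF x] by (simp add: real_approx_def[of "Suc n"])
  also have "\<dots> = G (v \<sigma>) (real_approx n (v \<sigma>) ?x)"
    using real_approx_in_ball[OF x] by (simp add: F_of_real)
  finally show ?thesis .
qed

lemma continuous_real_approx: "continuous_on (UNIV \<times> ball 0 r) (\<lambda>(\<sigma>, x). real_approx n \<sigma> x)"
proof (induction n)
  case 0
  show ?case by (simp add: real_approx_def case_prod_beta' continuous_on_snd)
next
  case (Suc n)
  let ?D = "UNIV \<times> ball 0 r :: ('a \<times> real) set"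
  have v: "continuous_on ?D (\<lambda>p. v (fst p))"
    by (rule continuous_on_compose2[OF cont_v]) (auto intro: continuous_intros)
  have "continuous_on ?D (\<lambda>p. a (v (fst p)))"
    by (rule continuous_on_compose2[OF continuous_multiplier v]) auto
  then have inner: "continuous_on ?D (\<lambda>p. (v (fst p), snd p / a (v (fst p))))"
    using A_nonzero by (intro continuous_intros v) auto
  have "(\<lambda>p. (v (fst p), snd p / a (v (fst p)))) ` ?D \<subseteq> ?D"
    by (intro image_subsetI SigmaI UNIV_I real_divide_in_ball) auto
  from continuous_on_compose2[OF Suc.IH inner this]
  have "continuous_on ?D (\<lambda>p. real_approx n (v (fst p)) (snd p / a (v (fst p))))" by simp
  then have outer: "continuous_on ?D (\<lambda>p. (v (fst p), real_approx n (v (fst p)) (snd p / a (v (fst p)))))"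
    by (intro continuous_on_Pair v)
  have "(\<lambda>p. (v (fst p), real_approx n (v (fst p)) (snd p / a (v (fst p))))) ` ?D \<subseteq> UNIV \<times> ball 0 \<gamma>"
    by (intro image_subsetI SigmaI UNIV_I real_approx_in_ball real_divide_in_ball) auto
  from continuous_on_compose2[OF jointly_continuous_G outer this]
  have "continuous_on ?D (\<lambda>p. G (v (fst p)) (real_approx n (v (fst p)) (snd p / a (v (fst p)))))"
    by simp
  then show ?case
    by (rule continuous_on_eq) (auto simp: real_approx_Suc)
qed

lemma continuous_real_linearizer: "continuous_on (UNIV \<times> ball 0 r) (\<lambda>(\<sigma>, x). real_linearizer \<sigma> x)"
proof (rule uniform_limit_theorem)
  show "\<forall>\<^sub>F n in sequentially. continuous_on (UNIV \<times> ball 0 r) (\<lambda>(\<sigma>, x). real_approx n \<sigma> x)"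
    by (intro always_eventually allI continuous_real_approx)
  show "uniform_limit (UNIV \<times> ball 0 r) (\<lambda>n (\<sigma>, x). real_approx n \<sigma> x)
      (\<lambda>(\<sigma>, x). real_linearizer \<sigma> x) sequentially"
  proof (rule uniform_limitI)
    fix e :: real assume "0 < e"
    from uniform_limitD[OF uniform_limit_approx this]
    have "\<forall>\<^sub>F n in sequentially. \<forall>\<sigma>. \<forall>z\<in>ball 0 r. dist (approx n \<sigma> z) (linearizer \<sigma> z) < e"
      by (rule eventually_mono) auto
    then show "\<forall>\<^sub>F n in sequentially. \<forall>p\<in>UNIV \<times> ball 0 r.
        dist (case p of (\<sigma>, x) \<Rightarrow> real_approx n \<sigma> x) (case p of (\<sigma>, x) \<Rightarrow> real_linearizer \<sigma> x) < e"
    proof (rule eventually_mono, clarify)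
      fix n \<sigma> and x :: real
      assume close: "\<forall>\<sigma>. \<forall>z\<in>ball 0 r. dist (approx n \<sigma> z) (linearizer \<sigma> z) < e" and "x \<in> ball 0 r"
      then have "dist (approx n \<sigma> (of_real x)) (linearizer \<sigma> (of_real x)) < e" by simp
      then show "dist (real_approx n \<sigma> x) (real_linearizer \<sigma> x) < e"
        using abs_Re_le_cmod[of "approx n \<sigma> (of_real x) - linearizer \<sigma> (of_real x)"]
        by (simp add: real_approx_def real_linearizer_def dist_norm)
    qed
  qed
qed simp

lemma real_linearizer_zero: "real_linearizer \<sigma> 0 = 0"
  by (simp add: real_linearizer_def linearizer_zero)

lemma strict_mono_real_linearizer: "strict_mono_on (ball 0 (r / 8)) (real_linearizer \<sigma>)"
proof (rule strict_mono_onI)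
  fix x y :: real
  assume xy: "x \<in> ball 0 (r / 8)" "y \<in> ball 0 (r / 8)" "x < y"
  have "\<bar>(real_linearizer \<sigma> y - y) - (real_linearizer \<sigma> x - x)\<bar>
      \<le> norm ((linearizer \<sigma> (of_real y) - of_real y) - (linearizer \<sigma> (of_real x) - of_real x))"
    using abs_Re_le_cmod[of "(linearizer \<sigma> (of_real y) - of_real y) - (linearizer \<sigma> (of_real x) - of_real x)"]
    by (simp add: real_linearizer_def)
  also have "\<dots> \<le> norm (complex_of_real y - of_real x) / 2"
    using xy by (intro linearizer_displacement_lipschitz) auto
  also have "\<dots> = (y - x) / 2" using xy by (simp flip: of_real_diff)
  finally show "real_linearizer \<sigma> x < real_linearizer \<sigma> y"
    using xy(3) unfolding abs_le_iff by argo
qed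

lemma real_linearizer_conjugates:
  assumes "a (v \<sigma>) * x \<in> ball 0 r"
  shows "G (v \<sigma>) (real_linearizer (v \<sigma>) x) = real_linearizer \<sigma> (a (v \<sigma>) * x)"
proof -
  have a: "a (v \<sigma>) \<noteq> 0" using A_nonzero[of "v \<sigma>"] by simp
  then have x: "x \<in> ball 0 r" using real_divide_in_ball[OF assms, of "v \<sigma>"] by simp
  then have "norm (linearizer (v \<sigma>) (of_real x) - of_real x) \<le> M * norm (complex_of_real x) ^ 2"
    by (intro linearizer_near_identity) simp
  then have "linearizer (v \<sigma>) (of_real x) \<in> ball 0 \<gamma>"
    using x by (intro in_domain[of "of_real x"]) auto
  then have dom: "\<bar>real_linearizer (v \<sigma>) x\<bar> < \<gamma>"
    using x by (simp flip: of_real_real_linearizer)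
  have "linearizer \<sigma> (of_real (a (v \<sigma>) * x)) = F (v \<sigma>) (linearizer (v \<sigma>) (of_real x))"
    using linearizer_conjugates[of "of_real (a (v \<sigma>) * x)" \<sigma>] assms a by (simp add: norm_mult abs_mult)
  also have "\<dots> = of_real (G (v \<sigma>) (real_linearizer (v \<sigma>) x))"
    using x dom by (simp add: F_of_real flip: of_real_real_linearizer)
  finally show ?thesis by (simp add: real_linearizer_def)
qed

lemma real_analytic_real_linearizer: "real_analytic_on (real_linearizer \<sigma>) (ball 0 r)"
  using real_analytic_on_Re_holomorphic[OF holomorphic_linearizer]
  by (simp add: real_linearizer_def[abs_def])

end

section \<open>The linearization theorem\<close>

text \<open>At \<open>\<delta> = 0\<close> the two inequalities read \<open>1 < \<Lambda>\<close> and
  \<open>\<Lambda> < \<Lambda>\<^sup>2\<close>; being strict, they persist for small \<open>\<delta>\<close>.\<close>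

lemma multiplier_gap_constant:
  fixes \<Lambda> :: real
  assumes "\<Lambda> > 1" and P: "\<forall>\<^sub>F \<delta> in at_right 0. P \<delta>"
  obtains \<delta> where "0 < \<delta>" "1 < \<Lambda> - \<delta>" "\<Lambda> + \<delta> < (\<Lambda> - \<delta>) ^ 2" "P \<delta>"
proof -
  have "((\<lambda>\<delta>. \<Lambda> - \<delta>) \<longlongrightarrow> \<Lambda> - 0) (at_right 0)" by (intro tendsto_intros)
  then have 1: "\<forall>\<^sub>F \<delta> in at_right 0. 1 < \<Lambda> - \<delta>"
    using assms(1) by (intro order_tendstoD) auto
  have "\<Lambda> * 1 < \<Lambda> * \<Lambda>" using assms(1) by (intro mult_strict_left_mono) auto
  moreover have "((\<lambda>\<delta>. (\<Lambda> - \<delta>) ^ 2 - (\<Lambda> + \<delta>)) \<longlongrightarrow> (\<Lambda> - 0) ^ 2 - (\<Lambda> + 0)) (at_right 0)"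
    by (intro tendsto_intros)
  ultimately have 2: "\<forall>\<^sub>F \<delta> in at_right 0. 0 < (\<Lambda> - \<delta>) ^ 2 - (\<Lambda> + \<delta>)"
    by (intro order_tendstoD(1)) (auto simp: power2_eq_square)
  have "\<forall>\<^sub>F \<delta> in at_right (0::real). 0 < \<delta>" by (rule eventually_at_right_less)
  with 1 2 P have "\<forall>\<^sub>F \<delta> in at_right 0. 0 < \<delta> \<and> 1 < \<Lambda> - \<delta> \<and> \<Lambda> + \<delta> < (\<Lambda> - \<delta>) ^ 2 \<and> P \<delta>"
    by eventually_elim auto
  from eventually_happens'[OF trivial_limit_at_right_real this] show thesis
    using that by blast
qed

theorem theorem2p4:
  fixes u :: "circle \<Rightarrow> circle"
    and \<Gamma> :: "circle \<Rightarrow> real \<Rightarrow> real"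
    and \<Lambda> :: real
  assumes "continuous_on UNIV u"
    and "bij u"
    and "\<And>\<sigma>. real_analytic_on (\<Gamma> \<sigma>) UNIV"
    and "\<And>\<rho>. continuous_on UNIV (\<lambda>\<sigma>. \<Gamma> \<sigma> \<rho>)"
    and "\<And>\<sigma>. \<Gamma> \<sigma> 0 = 0"
    and "\<Lambda> > 1"
    and "\<forall>\<^sub>F \<delta> in at_right (0::real). \<exists>\<gamma>>0. \<forall>\<sigma>. \<exists>F. complex_extension (\<Gamma> \<sigma>) \<gamma> F \<and>
           (\<forall>z\<in>cball 0 \<gamma>. norm (deriv F z - of_real \<Lambda>) < \<delta>)"
  shows "\<exists>U V H K.
    open U \<and> zero_circle \<subseteq> U \<and> open V \<and>
    homeomorphism U V H K \<and>
    H ` zero_circle = zero_circle \<and>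
    analytic_in_fibres H U \<and>
    (\<exists>W. open W \<and> zero_circle \<subseteq> W \<and> W \<subseteq> U \<and>
      (\<forall>p\<in>W. skew_product u \<Gamma> (H p) \<in> V \<and>
        K (skew_product u \<Gamma> (H p)) = skew_product u (\<lambda>\<sigma> \<rho>. deriv (\<Gamma> \<sigma>) 0 * \<rho>) p))"
proof -
  obtain \<delta> where \<delta>: "0 < \<delta>" "1 < \<Lambda> - \<delta>" "\<Lambda> + \<delta> < (\<Lambda> - \<delta>) ^ 2"
    and "\<exists>\<gamma>>0. \<forall>\<sigma>. \<exists>F. complex_extension (\<Gamma> \<sigma>) \<gamma> F \<and>
           (\<forall>z\<in>cball 0 \<gamma>. norm (deriv F z - of_real \<Lambda>) < \<delta>)"
    by (rule multiplier_gap_constant[OF assms(6,7)])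
  then obtain \<gamma> F where "0 < \<gamma>" and ext: "\<And>\<sigma>. complex_extension (\<Gamma> \<sigma>) \<gamma> (F \<sigma>)"
    and deriv_bound: "\<And>\<sigma> z. z \<in> cball 0 \<gamma> \<Longrightarrow> norm (deriv (F \<sigma>) z - of_real \<Lambda>) < \<delta>"
    by metis
  define a where "a \<sigma> = deriv (\<Gamma> \<sigma>) 0" for \<sigma>
  define L where "L = \<Lambda> + \<delta>"
  define m where "m = \<Lambda> - \<delta>"
  define C where "C = 2 * \<delta> / \<gamma>"
  (* The largest radius permitted by the two upper bounds in the locale. *)
  define r where "r = min (\<gamma> / 2) ((1 - L / m ^ 2) / C)"
  have hol: "F \<sigma> holomorphic_on ball 0 \<gamma>" for \<sigma>
    using ext[of \<sigma>] analytic_imp_holomorphic holomorphic_on_subset ball_subset_cball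
    unfolding complex_extension_def by blast
  have F_of_real: "F \<sigma> (of_real x) = of_real (\<Gamma> \<sigma> x)" if "\<bar>x\<bar> < \<gamma>" for \<sigma> x
    using ext[of \<sigma>] that unfolding complex_extension_def by auto
  have F_zero: "F \<sigma> 0 = 0" for \<sigma>
    using F_of_real[of 0 \<sigma>] \<open>0 < \<gamma>\<close> assms(5) by simp
  have der: "(F \<sigma> has_field_derivative deriv (F \<sigma>) z) (at z)" if "z \<in> ball 0 \<gamma>" for \<sigma> z
    using hol that by (intro holomorphic_derivI) auto
  have deriv_zero: "deriv (F \<sigma>) 0 = of_real (a \<sigma>)" for \<sigma>
    unfolding a_def
    by (rule real_derivative_of_complex_extension[OF der]) (use \<open>0 < \<gamma>\<close> F_of_real in auto)
  have a_near: "\<bar>a \<sigma> - \<Lambda>\<bar> < \<delta>" for \<sigma>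
    using deriv_bound[of 0 \<sigma>] \<open>0 < \<gamma>\<close> by (simp add: deriv_zero flip: of_real_diff)
  have gap: "L / m ^ 2 < 1" using \<delta> by (simp add: L_def m_def)
  have "0 < C" using \<delta> \<open>0 < \<gamma>\<close> by (simp add: C_def)

  interpret real_expanding_cocycle "inv u" F a \<gamma> L m C r \<Gamma>
  proof unfold_locales
    fix \<sigma> and z w :: complex
    assume z: "z \<in> ball 0 \<gamma>"
    show "norm (F \<sigma> z - of_real (a \<sigma>) * z) \<le> C * norm z ^ 2"
      unfolding C_def deriv_zero[symmetric]
      using deriv_bound by (intro quadratic_remainder[where c = "of_real \<Lambda>", OF hol \<open>0 < \<gamma>\<close> F_zero \<open>0 < \<delta>\<close> _ z]) auto
    assume w: "w \<in> ball 0 \<gamma>"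
    show "norm (F \<sigma> z - F \<sigma> w) \<le> L * norm (z - w)"
    proof (rule field_differentiable_bound[OF convex_ball _ _ z w])
      fix x :: complex assume x: "x \<in> ball 0 \<gamma>"
      show "(F \<sigma> has_field_derivative deriv (F \<sigma>) x) (at x within ball 0 \<gamma>)"
        using der[OF x] by (rule has_field_derivative_at_within)
      show "norm (deriv (F \<sigma>) x) \<le> L"
        using deriv_bound[of x \<sigma>] x norm_triangle_sub[of "deriv (F \<sigma>) x" "of_real \<Lambda>"] \<open>\<Lambda> > 1\<close>
        by (simp add: L_def)
    qed
  next
    show "m \<le> norm (complex_of_real (a \<sigma>))" for \<sigma>
      using a_near[of \<sigma>] by (simp add: m_def)
    show "0 < r" using \<open>0 < \<gamma>\<close> \<open>0 < C\<close> gap by (simp add: r_def)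
    have "C * r \<le> C * ((1 - L / m ^ 2) / C)"
      unfolding r_def using \<open>0 < C\<close> by (intro mult_left_mono) auto
    then show "C * r \<le> 1 - L / m ^ 2" using \<open>0 < C\<close> by simp
    show "continuous_on UNIV (inv u)" using assms(1,2) by (rule continuous_on_circle_inv)
  qed (use \<delta> \<open>\<Lambda> > 1\<close> \<open>0 < C\<close> hol F_of_real assms(4) in \<open>auto simp: L_def m_def r_def\<close>)

  define s where "s = r / 8"
  define H where "H = (\<lambda>(\<sigma>, x). (\<sigma>, real_linearizer \<sigma> x))"
  define U :: "(circle \<times> real) set" where "U = UNIV \<times> ball 0 s"
  (* The linear map expands by less than L, so it sends this strip into U. *)
  define W :: "(circle \<times> real) set" where "W = UNIV \<times> ball 0 (s / L)"
  have "0 < s" "ball 0 s \<subseteq> ball (0::real) r" using radius by (auto simp: s_def)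
  have "1 < L" using \<delta> \<open>\<Lambda> > 1\<close> by (simp add: L_def)
  have "continuous_on U (\<lambda>(\<sigma>, x). real_linearizer \<sigma> x)"
    unfolding U_def using \<open>ball 0 s \<subseteq> ball 0 r\<close>
    by (intro continuous_on_subset[OF continuous_real_linearizer]) auto
  from fibrewise_strict_mono_homeomorphism[OF this[unfolded U_def] open_ball
      strict_mono_real_linearizer[folded s_def]]
  obtain K where "open (H ` U)" and K: "homeomorphism U (H ` U) H K"
    unfolding H_def U_def by blast
  have "open U" "open W" unfolding U_def W_def by (intro open_Times open_UNIV open_ball)+
  have "s / L \<le> s / 1" using \<open>1 < L\<close> \<open>0 < s\<close> by (intro divide_left_mono) auto
  then have "ball 0 (s / L) \<subseteq> ball (0::real) s" by (intro subset_ball) simp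
  then have "W \<subseteq> U" unfolding W_def U_def by (intro Sigma_mono) auto
  have conj: "skew_product u \<Gamma> (H p) \<in> H ` U \<and>
      K (skew_product u \<Gamma> (H p)) = skew_product u (\<lambda>\<sigma> x. deriv (\<Gamma> \<sigma>) 0 * x) p"
    if W: "p \<in> W" for p
  proof -
    obtain \<sigma> x where p: "p = (\<sigma>, x)" and x: "\<bar>x\<bar> < s / L" using W by (cases p) (auto simp: W_def)
    have "\<bar>a \<sigma> * x\<bar> \<le> L * \<bar>x\<bar>"
      using a_near[of \<sigma>] \<open>\<Lambda> > 1\<close> \<delta> unfolding abs_mult L_def by (intro mult_right_mono) auto
    also have "\<dots> < s" using x \<open>1 < L\<close> by (simp add: field_simps)
    finally have ax: "a \<sigma> * x \<in> ball 0 s" by simp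
    have "inv u (u \<sigma>) = \<sigma>" using assms(2) by (simp add: bij_is_inj)
    then have "\<Gamma> \<sigma> (real_linearizer \<sigma> x) = real_linearizer (u \<sigma>) (a \<sigma> * x)"
      using real_linearizer_conjugates[of "u \<sigma>" x] ax \<open>ball 0 s \<subseteq> ball 0 r\<close> by auto
    then have "skew_product u \<Gamma> (H p) = H (u \<sigma>, a \<sigma> * x)"
      by (simp add: skew_product_def H_def p)
    moreover have "(u \<sigma>, a \<sigma> * x) \<in> U" using ax by (simp add: U_def)
    ultimately show ?thesis
      using homeomorphism_apply1[OF K] by (simp add: skew_product_def p a_def)
  qed
  have "analytic_in_fibres H U"
  proof -
    have "real_analytic_on (real_linearizer \<sigma>) (ball 0 s)" for \<sigma>
      using real_analytic_real_linearizer \<open>ball 0 s \<subseteq> ball 0 r\<close>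
      unfolding real_analytic_on_def by blast
    then show ?thesis
      by (simp add: analytic_in_fibres_def H_def U_def circle_analytic_on_const ball_def)
  qed
  moreover have "H ` zero_circle = zero_circle"
    by (force simp: H_def zero_circle_def real_linearizer_zero)
  moreover have "zero_circle \<subseteq> W" "zero_circle \<subseteq> U"
    using \<open>0 < s\<close> \<open>1 < L\<close> by (auto simp: zero_circle_def W_def U_def)
  moreover have "\<exists>W. open W \<and> zero_circle \<subseteq> W \<and> W \<subseteq> U \<and>
      (\<forall>p\<in>W. skew_product u \<Gamma> (H p) \<in> H ` U \<and>
        K (skew_product u \<Gamma> (H p)) = skew_product u (\<lambda>\<sigma> \<rho>. deriv (\<Gamma> \<sigma>) 0 * \<rho>) p)"
    by (rule exI[of _ W]) (intro conjI ballI conj[THEN conjunct1] conj[THEN conjunct2]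
        \<open>open W\<close> \<open>zero_circle \<subseteq> W\<close> \<open>W \<subseteq> U\<close>)
  ultimately have "open U \<and> zero_circle \<subseteq> U \<and> open (H ` U) \<and> homeomorphism U (H ` U) H K \<and>
      H ` zero_circle = zero_circle \<and> analytic_in_fibres H U \<and>
      (\<exists>W. open W \<and> zero_circle \<subseteq> W \<and> W \<subseteq> U \<and>
        (\<forall>p\<in>W. skew_product u \<Gamma> (H p) \<in> H ` U \<and>
          K (skew_product u \<Gamma> (H p)) = skew_product u (\<lambda>\<sigma> \<rho>. deriv (\<Gamma> \<sigma>) 0 * \<rho>) p))"
    by (intro conjI \<open>open U\<close> \<open>open (H ` U)\<close> K)
  then show ?thesis by (intro exI)
qed

end
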